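(* For every integer $\ell\ge 1$, the comb full binary tree $C_\ell$, which has $n=2\ell+1$ vertices, admits a graceful labeling $f$ such that, for some longest root-to-leaf path $u_0u_1\cdots u_d$ of $C_\ell$ (with $u_0$ the root and $d$ its number of edges), the restriction of $f$ to that path is the alternating extreme spine assignment, i.e. for $0\le i\le d$, $$f(u_i)=\begin{cases} i/2, & i\text{ even},\\ n-1-(i-1)/2, & i\text{ odd}.\end{cases}$$
   Context: A graceful labeling of a tree $T$ with $n$ vertices is a bijection $f:V(T)\to\{0,1,\dots,n-1\}$ such that the set of induced edge labels $\{|f(u)-f(v)|: uv\in E(T)\}$ equals $\{1,2,\dots,n-1\}$. A full binary tree is a rooted tree in which every non-leaf vertex has exactly two children. Path length is the number of edges. For $\ell\ge1$, the comb $C_\ell$ is the rooted full binary tree with root $v_0$, internal vertices $v_0,v_1,\dots,v_{\ell-1}$ and leaves $w_0,w_1,\dots,w_{\ell-1},v_\ell$, where for $0\le i\le \ell-1$ the two children of $v_i$ are $v_{i+1}$ and $w_i$. *)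

theory Defs
  imports "Graph_Theory.Graph_Theory"
begin

text \<open>
  A rooted tree is represented by the digraph whose arcs point from parents to children,
  together with its root; the edges \<open>uv\<close> of the underlying undirected tree are the arcs
  with their orientation forgotten. Uniqueness is required of all directed walks
  from the root, not only of the simple ones: otherwise an additional arc
  from a vertex back to one of its ancestors would go unnoticed.
\<close>

definition rooted_tree :: "'a pair_pre_digraph \<Rightarrow> 'a \<Rightarrow> bool" where
  "rooted_tree T r \<longleftrightarrow> pair_fin_digraph T \<and> r \<in> pverts T \<and>
     (\<forall>v\<in>pverts T. \<exists>!p. vwalk p (with_proj T) \<and> hd p = r \<and> last p = v)"

definition children :: "'a pair_pre_digraph \<Rightarrow> 'a \<Rightarrow> 'a set" where
  "children T v = {w. (v, w) \<in> parcs T}"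

definition leaf :: "'a pair_pre_digraph \<Rightarrow> 'a \<Rightarrow> bool" where
  "leaf T v \<longleftrightarrow> v \<in> pverts T \<and> children T v = {}"

definition full_binary_tree :: "'a pair_pre_digraph \<Rightarrow> 'a \<Rightarrow> bool" where
  "full_binary_tree T r \<longleftrightarrow> rooted_tree T r \<and>
     (\<forall>v\<in>pverts T. \<not> leaf T v \<longrightarrow> card (children T v) = 2)"

definition root_leaf_path :: "'a pair_pre_digraph \<Rightarrow> 'a \<Rightarrow> 'a list \<Rightarrow> bool" where
  "root_leaf_path T r p \<longleftrightarrow> vpath p (with_proj T) \<and> hd p = r \<and> leaf T (last p)"

definition longest_root_leaf_path :: "'a pair_pre_digraph \<Rightarrow> 'a \<Rightarrow> 'a list \<Rightarrow> bool" where
  "longest_root_leaf_path T r p \<longleftrightarrow> root_leaf_path T r p \<and>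
     (\<forall>q. root_leaf_path T r q \<longrightarrow> vwalk_length q \<le> vwalk_length p)"

text \<open>The induced edge labels do not depend on the orientation of the arcs.\<close>

definition graceful_labeling :: "'a pair_pre_digraph \<Rightarrow> ('a \<Rightarrow> nat) \<Rightarrow> bool" where
  "graceful_labeling T f \<longleftrightarrow> bij_betw f (pverts T) {0..<card (pverts T)} \<and>
     {\<bar>int (f u) - int (f v)\<bar> | u v. (u, v) \<in> parcs T} = {1..int (card (pverts T)) - 1}"

datatype comb_vertex = V nat | W nat

definition comb :: "nat \<Rightarrow> comb_vertex pair_pre_digraph" where
  "comb l = \<lparr> pverts = {V i | i. i \<le> l} \<union> {W i | i. i < l},
              parcs = {(V i, V (Suc i)) | i. i < l} \<union> {(V i, W i) | i. i < l} \<rparr>"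

end

theory Submission
  imports Defs
begin

text \<open>
  Along the spine the labels \<open>0, 2l, 1, 2l - 1, \<dots>\<close> induce the edge labels
  \<open>2l, 2l - 1, \<dots>, l + 1\<close>, so the pendant edges have to receive \<open>1, \<dots>, l\<close>. Giving the edge
  \<open>v\<^sub>i w\<^sub>i\<close> the label \<open>l - i\<close>, directed towards the middle of the label range, makes the leaves
  alternate outwards from the middle, \<open>l, l + 1, l - 1, l + 2, \<dots>\<close>, and these are exactly the
  labels that the spine leaves unused.
\<close>

fun comb_label :: "nat \<Rightarrow> comb_vertex \<Rightarrow> nat" where
  "comb_label l (V i) = (if even i then i div 2 else 2 * l - (i - 1) div 2)"
| "comb_label l (W i) = (if even i then l - i div 2 else l + (i + 1) div 2)"

text \<open>The candidate for the only walk from the root to a vertex. Having it explicitly turns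
  uniqueness of walks into an equation and makes path lengths computable.\<close>

fun comb_walk :: "comb_vertex \<Rightarrow> comb_vertex list" where
  "comb_walk (V i) = map V [0..<Suc i]"
| "comb_walk (W i) = map V [0..<Suc i] @ [W i]"

lemma V_in_pverts_comb [simp]: "V i \<in> pverts (comb l) \<longleftrightarrow> i \<le> l"
  and W_in_pverts_comb [simp]: "W i \<in> pverts (comb l) \<longleftrightarrow> i < l"
  by (auto simp: comb_def)

lemma parcs_comb_iff:
  "(u, v) \<in> parcs (comb l) \<longleftrightarrow> (\<exists>i<l. u = V i \<and> (v = V (Suc i) \<or> v = W i))"
  by (auto simp: comb_def)

lemma pverts_comb: "pverts (comb l) = V ` {..l} \<union> W ` {..<l}"
  by (auto simp: comb_def)

lemma card_pverts_comb: "card (pverts (comb l)) = 2 * l + 1"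
proof -
  have "card (pverts (comb l)) = card (V ` {..l}) + card (W ` {..<l})"
    unfolding pverts_comb by (rule card_Un_disjoint) auto
  then show ?thesis
    by (simp add: card_image inj_on_def)
qed

lemma pair_fin_digraph_comb: "pair_fin_digraph (comb l)"
proof
  show "finite (parcs (comb l))"
  proof (rule finite_subset)
    show "parcs (comb l) \<subseteq> (\<lambda>i. (V i, V (Suc i))) ` {..<l} \<union> (\<lambda>i. (V i, W i)) ` {..<l}"
      by (auto simp: comb_def)
  qed simp
qed (auto simp: comb_def)

lemma children_comb_V: "i < l \<Longrightarrow> children (comb l) (V i) = {V (Suc i), W i}"
  by (auto simp: children_def parcs_comb_iff)

lemma leaf_comb: "leaf (comb l) v \<longleftrightarrow> v = V l \<or> (\<exists>i<l. v = W i)"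
  by (cases v) (auto simp: leaf_def children_def parcs_comb_iff)

lemma comb_walk_ne [simp]: "comb_walk v \<noteq> []"
  by (cases v) simp_all

lemma hd_comb_walk [simp]: "hd (comb_walk v) = V 0"
  by (cases v) (simp_all add: hd_append hd_map del: upt_Suc)

lemma last_comb_walk [simp]: "last (comb_walk v) = v"
  by (cases v) simp_all

lemma distinct_comb_walk: "distinct (comb_walk v)"
  by (cases v) (auto simp: distinct_map inj_on_def)

text \<open>Reflects that each arc enters its head from the only possible parent. Both the existence
  and the uniqueness of walks from the root are inductions over this equation.\<close>

lemma comb_walk_snoc:
  assumes "(u, v) \<in> parcs (comb l)"
  shows "comb_walk v = comb_walk u @ [v]"
  using assms by (auto simp: parcs_comb_iff)

lemma vwalk_snoc_iff:
  assumes "p \<noteq> []"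
  shows "vwalk (p @ [v]) G \<longleftrightarrow> vwalk p G \<and> v \<in> verts G \<and> (last p, v) \<in> arcs_ends G"
  using assms by (auto simp: vwalk_def vwalk_arcs_append)

lemma vwalk_comb_walk:
  assumes "v \<in> pverts (comb l)"
  shows "vwalk (comb_walk v) (with_proj (comb l))"
proof -
  \<comment> \<open>Only the spine needs induction: the walk to \<open>W i\<close> is the one to
    \<open>V i\<close> with a single arc added.\<close>
  have V: "vwalk (comb_walk (V i)) (with_proj (comb l))" if "i \<le> l" for i
    using that
  proof (induction i)
    case 0
    show ?case by (auto simp: vwalk_def)
  next
    case (Suc i)
    then have "(V i, V (Suc i)) \<in> parcs (comb l)"
      by (auto simp: parcs_comb_iff)
    with Suc show ?case
      by (simp add: comb_walk_snoc vwalk_snoc_iff del: comb_walk.simps)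
  qed
  show ?thesis
  proof (cases v)
    case (W i)
    with assms have "(V i, W i) \<in> parcs (comb l)"
      by (auto simp: parcs_comb_iff)
    with V[of i] W assms show ?thesis
      by (simp add: comb_walk_snoc vwalk_snoc_iff del: comb_walk.simps)
  qed (use V assms in auto)
qed

text \<open>Induction from the far end: the walk without its last vertex is canonical, and its last
  arc extends it canonically. Repeated vertices are not excluded beforehand, as
  \<open>rooted_tree\<close> speaks of all walks.\<close>

lemma vwalk_comb_unique:
  assumes "vwalk p (with_proj (comb l))" and "hd p = V 0"
  shows "p = comb_walk (last p)"
  using assms
proof (induction p rule: rev_induct)
  case (snoc v p)
  show ?case
  proof (cases "p = []")
    case False
    with snoc.prems have p: "vwalk p (with_proj (comb l))" "hd p = V 0"
      and "(last p, v) \<in> parcs (comb l)"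
      by (auto simp: vwalk_snoc_iff)
    from this(3) have "comb_walk v = comb_walk (last p) @ [v]"
      by (rule comb_walk_snoc)
    with snoc.IH[OF p] show ?thesis
      by (metis last_snoc)
  qed (use snoc.prems in auto)
qed (simp add: vwalk_def)

lemma full_binary_tree_comb: "full_binary_tree (comb l) (V 0)"
proof -
  have "\<exists>!p. vwalk p (with_proj (comb l)) \<and> hd p = V 0 \<and> last p = v"
    if "v \<in> pverts (comb l)" for v
    using vwalk_comb_walk[OF that] vwalk_comb_unique hd_comb_walk last_comb_walk by metis
  moreover have "card (children (comb l) v) = 2"
    if "v \<in> pverts (comb l)" and "\<not> leaf (comb l) v" for v
    using that by (cases v) (auto simp: leaf_comb children_comb_V)
  ultimately show ?thesis
    by (simp add: full_binary_tree_def rooted_tree_def pair_fin_digraph_comb)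
qed

text \<open>By uniqueness every competitor is some \<open>comb_walk v\<close>, so it suffices to
  compare lengths: \<open>l + 1\<close> vertices for \<open>V l\<close> against \<open>i + 2\<close>
  for \<open>W i\<close> with \<open>i < l\<close>.\<close>

lemma longest_root_leaf_path_comb: "longest_root_leaf_path (comb l) (V 0) (comb_walk (V l))"
proof -
  have "length (comb_walk v) \<le> length (comb_walk (V l))" if "v \<in> pverts (comb l)" for v
    using that by (cases v) auto
  moreover have "last q \<in> pverts (comb l) \<and> q = comb_walk (last q)"
    if "root_leaf_path (comb l) (V 0) q" for q
    using that vwalk_comb_unique unfolding root_leaf_path_def vpath_def leaf_def by blast
  moreover have "root_leaf_path (comb l) (V 0) (comb_walk (V l))"
    unfolding root_leaf_path_def vpath_def
    by (simp add: vwalk_comb_walk distinct_comb_walk leaf_comb del: comb_walk.simps)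
  ultimately show ?thesis
    unfolding longest_root_leaf_path_def vwalk_length_simp by (metis diff_le_mono)
qed

lemma comb_label_surj:
  assumes "m \<le> 2 * l"
  shows "m \<in> comb_label l ` pverts (comb l)"
proof -
  \<comment> \<open>From bottom to top, the label range splits into four blocks: even spine
    vertices, even leaves, odd leaves, odd spine vertices. Each witness inverts the formula for its
    block.\<close>
  consider "2 * m \<le> l" | "l < 2 * m" "m \<le> l" | "l < m" "2 * (m - l) \<le> l" | "l < 2 * (m - l)"
    by linarith
  then show ?thesis
  proof cases
    case 1
    then show ?thesis
      by (intro image_eqI[of _ _ "V (2 * m)"]) auto
  next
    case 2
    then show ?thesis
      by (intro image_eqI[of _ _ "W (2 * (l - m))"]) auto
  next
    case 3
    then show ?thesis
      by (intro image_eqI[of _ _ "W (Suc (2 * (m - Suc l)))"]) auto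
  next
    case 4
    with assms show ?thesis
      by (intro image_eqI[of _ _ "V (Suc (2 * (2 * l - m)))"]) auto
  qed
qed

lemma comb_label_le: "v \<in> pverts (comb l) \<Longrightarrow> comb_label l v \<le> 2 * l"
  by (cases v) auto

lemma bij_betw_comb_label: "bij_betw (comb_label l) (pverts (comb l)) {0..<2 * l + 1}"
proof -
  have image: "comb_label l ` pverts (comb l) = {0..<2 * l + 1}"
    by (auto dest: comb_label_le intro: comb_label_surj)
  \<comment> \<open>Injectivity comes from counting: the image has \<open>2 * l + 1\<close>
    elements, as many as there are vertices.\<close>
  moreover have "inj_on (comb_label l) (pverts (comb l))"
    by (rule eq_card_imp_inj_on)
      (simp_all add: image card_pverts_comb pair_fin_digraph.pair_finite_verts[OF pair_fin_digraph_comb])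
  ultimately show ?thesis
    by (simp add: bij_betw_def)
qed

text \<open>Each step along the spine replaces one of the two current extremes by its inner
  neighbour, so the difference drops by one.\<close>

lemma comb_label_spine_edge:
  "i < l \<Longrightarrow> \<bar>int (comb_label l (V i)) - int (comb_label l (V (Suc i)))\<bar> = 2 * int l - int i"
  by (auto elim!: evenE oddE)

lemma comb_label_pendant_edge:
  "i < l \<Longrightarrow> \<bar>int (comb_label l (V i)) - int (comb_label l (W i))\<bar> = int l - int i"
  by (auto elim!: evenE oddE)

lemma graceful_labeling_comb: "graceful_labeling (comb l) (comb_label l)"
proof -
  have "{\<bar>int (comb_label l u) - int (comb_label l v)\<bar> | u v. (u, v) \<in> parcs (comb l)}
      = (\<lambda>i. 2 * int l - int i) ` {..<l} \<union> (\<lambda>i. int l - int i) ` {..<l}" (is "?E = ?A \<union> ?B")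
  proof -
    have "?E = (\<lambda>i. \<bar>int (comb_label l (V i)) - int (comb_label l (V (Suc i)))\<bar>) ` {..<l} \<union>
      (\<lambda>i. \<bar>int (comb_label l (V i)) - int (comb_label l (W i))\<bar>) ` {..<l}"
      by (force simp: parcs_comb_iff simp del: comb_label.simps)
    also have "\<dots> = ?A \<union> ?B"
      by (intro arg_cong2[of _ _ _ _ "(\<union>)"] image_cong refl)
        (simp_all add: comb_label_spine_edge comb_label_pendant_edge del: comb_label.simps)
    finally show ?thesis .
  qed
  also have "\<dots> = {1..2 * int l}"
  proof (rule set_eqI)
    fix k :: int
    \<comment> \<open>The witness solves \<open>2 * l - i = k\<close> for \<open>i\<close>; the
      assumption \<open>l < k\<close> is what gives \<open>i < l\<close>.\<close>
    have "k \<in> ?A" if "int l < k" "k \<le> 2 * int l"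
      using that by (intro image_eqI[of _ _ "nat (2 * int l - k)"]) auto
    moreover have "k \<in> ?B" if "1 \<le> k" "k \<le> int l"
      using that by (intro image_eqI[of _ _ "nat (int l - k)"]) auto
    ultimately show "k \<in> ?A \<union> ?B \<longleftrightarrow> k \<in> {1..2 * int l}"
      by force
  qed
  finally show ?thesis
    using bij_betw_comb_label by (simp add: graceful_labeling_def card_pverts_comb)
qed

theorem theorem2p4:
  fixes l n :: nat
  assumes "l \<ge> 1" and "n = 2 * l + 1"
  shows "full_binary_tree (comb l) (V 0) \<and> card (pverts (comb l)) = n \<and>
    (\<exists>f us. graceful_labeling (comb l) f \<and> longest_root_leaf_path (comb l) (V 0) us \<and>
       (\<forall>i\<le>vwalk_length us.
          f (us ! i) = (if even i then i div 2 else n - 1 - (i - 1) div 2)))"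
proof (intro conjI exI[of _ "comb_label l"] exI[of _ "comb_walk (V l)"])
  show "\<forall>i\<le>vwalk_length (comb_walk (V l)).
      comb_label l (comb_walk (V l) ! i) = (if even i then i div 2 else n - 1 - (i - 1) div 2)"
    \<comment> \<open>The path has \<open>l\<close> edges and its entry at \<open>i\<close> is
      \<open>V i\<close>, so the claim is the spine case of \<open>comb_label\<close> with
      \<open>2 * l = n - 1\<close>.\<close>
    using assms(2) by (simp del: upt_Suc)
qed (simp_all add: assms(2) full_binary_tree_comb card_pverts_comb graceful_labeling_comb
    longest_root_leaf_path_comb del: comb_walk.simps)

end
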